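(* Assume that $N\to\infty$, $n\to\infty$, $p=n/N\to 0$ and $M\to\infty$, $m\to\infty$, $q=m/M\to 0$, and let $a=a_{n,m,N,M}>0$. Put $$A = \frac{a \sqrt{nm}}{ \sqrt{2(n \log(p^{-1})+m \log(q^{-1} ) )} },\quad A_1 = \frac{a \sqrt{m}}{ \sqrt{2}\, (\sqrt{\log(n)}+\sqrt{\log(N-n)}) },\quad A_2 = \frac{a \sqrt{n}}{ \sqrt{2}\, (\sqrt{\log(m)}+\sqrt{\log(M-m)})},$$ and $B_{n,m,N,M}=\min\{A_1,A_2,A\}$. If $$\limsup B_{n,m,N,M} < 1,$$ then there is no consistent selection of $C_0$ uniformly over $\mathcal{S}_{nm,a}$, that is, $$\inf_{\hat C}\ \sup_{S_{C_0}\in\mathcal{S}_{nm,a}}P_{C_0}(\hat C(Y)\ne C_0)\longrightarrow 1,$$ where the infimum is taken over all selectors, i.e. all measurable functions $\hat C=\hat C(Y)$ with values in $\mathcal{C}_{nm}$.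
   Context: Model: one observes an $N\times M$ random matrix $Y=\{Y_{ij}\}$, $Y_{ij}=s_{ij}+\xi_{ij}$, $i=1,\dots,N$, $j=1,\dots,M$, where the $\xi_{ij}$ are i.i.d. standard Gaussian $\mathcal{N}(0,1)$ and $s_{ij}\in\mathbb{R}$ are deterministic. $\mathcal{C}_{nm}$ is the collection of all sets $C=A\times B\subset\{1,\dots,N\}\times\{1,\dots,M\}$ with $\mathrm{Card}(A)=n$, $\mathrm{Card}(B)=m$ (here $A,B$ are index sets, unrelated to the real numbers $A$, $B_{n,m,N,M}$ of the claim). For $a>0$, $\mathcal{S}_{nm,a}$ is the set of all real $N\times M$ matrices $S=S_{C}=\{s_{ij}\}$ for which there is $C\in\mathcal{C}_{nm}$ such that $s_{ij}=0$ if $(i,j)\notin C$ and $s_{ij}\ge a$ if $(i,j)\in C$; the set $C$ is determined by $S$ (it is the support of $S$), and $S_C$ denotes such a matrix with support $C$. $P_{C}$ denotes the law of $Y$ when the mean matrix is $S=S_C$; the supremum over $S_{C_0}\in\mathcal{S}_{nm,a}$ runs over all matrices in the class, $C_0$ being the support of the matrix. Asymptotics: $n=n_{NM}$, $m=m_{NM}$ and $a$ depend on $N,M$; all limits, $\liminf$ and $\limsup$ are taken as $N,M\to\infty$. *)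

theory Defs
  imports "HOL-Probability.Probability"
begin

text \<open>An \<open>N \<times> M\<close> matrix is a function on index pairs that is extensional, i.e. \<open>undefined\<close>
  outside the index set.\<close>

definition entries :: "nat \<Rightarrow> nat \<Rightarrow> (nat \<times> nat) set" where
  "entries N M = {1..N} \<times> {1..M}"

definition matrix_space :: "nat \<Rightarrow> nat \<Rightarrow> (nat \<times> nat \<Rightarrow> real) measure" where
  "matrix_space N M = Pi\<^sub>M (entries N M) (\<lambda>_. borel)"

definition noise_law :: "nat \<Rightarrow> nat \<Rightarrow> (nat \<times> nat \<Rightarrow> real) measure" where
  "noise_law N M = Pi\<^sub>M (entries N M) (\<lambda>_. density lborel (\<lambda>x. ennreal (std_normal_density x)))"

definition obs_law :: "nat \<Rightarrow> nat \<Rightarrow> (nat \<times> nat \<Rightarrow> real) \<Rightarrow> (nat \<times> nat \<Rightarrow> real) measure" where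
  "obs_law N M s = distr (noise_law N M) (matrix_space N M) (\<lambda>\<xi>. \<lambda>ij\<in>entries N M. s ij + \<xi> ij)"

definition submatrices :: "nat \<Rightarrow> nat \<Rightarrow> nat \<Rightarrow> nat \<Rightarrow> (nat \<times> nat) set set" where
  "submatrices N M n m = {A \<times> B | A B. A \<subseteq> {1..N} \<and> B \<subseteq> {1..M} \<and> card A = n \<and> card B = m}"

definition signals :: "nat \<Rightarrow> nat \<Rightarrow> nat \<Rightarrow> nat \<Rightarrow> real \<Rightarrow> (nat \<times> nat \<Rightarrow> real) set" where
  "signals N M n m a =
    {s \<in> entries N M \<rightarrow>\<^sub>E UNIV. \<exists>C \<in> submatrices N M n m.
       (\<forall>ij \<in> entries N M - C. s ij = 0) \<and> (\<forall>ij \<in> C. s ij \<ge> a)}"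

text \<open>For \<open>a > 0\<close> the set \<open>C\<close> witnessing membership in \<^const>\<open>signals\<close> is unique and equal to this
  support.\<close>

definition support :: "nat \<Rightarrow> nat \<Rightarrow> (nat \<times> nat \<Rightarrow> real) \<Rightarrow> (nat \<times> nat) set" where
  "support N M s = {ij \<in> entries N M. s ij \<noteq> 0}"

definition selectors ::
    "nat \<Rightarrow> nat \<Rightarrow> nat \<Rightarrow> nat \<Rightarrow> ((nat \<times> nat \<Rightarrow> real) \<Rightarrow> (nat \<times> nat) set) set" where
  "selectors N M n m = matrix_space N M \<rightarrow>\<^sub>M count_space (submatrices N M n m)"

text \<open>The infimum and supremum are those of the reals. For \<open>n \<le> N\<close> and \<open>m \<le> M\<close> they range over
  nonempty sets of values in \<open>[0, 1]\<close>.\<close>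

definition minimax_error :: "nat \<Rightarrow> nat \<Rightarrow> nat \<Rightarrow> nat \<Rightarrow> real \<Rightarrow> real" where
  "minimax_error N M n m a =
    (INF Chat \<in> selectors N M n m. SUP s \<in> signals N M n m a.
       measure (obs_law N M s) {Y \<in> space (matrix_space N M). Chat Y \<noteq> support N M s})"

definition bound_A :: "nat \<Rightarrow> nat \<Rightarrow> nat \<Rightarrow> nat \<Rightarrow> real \<Rightarrow> real" where
  "bound_A N M n m a =
    (let p = real n / real N; q = real m / real M
     in a * sqrt (real n * real m) / sqrt (2 * (real n * ln (inverse p) + real m * ln (inverse q))))"

definition bound_A1 :: "nat \<Rightarrow> nat \<Rightarrow> nat \<Rightarrow> nat \<Rightarrow> real \<Rightarrow> real" where
  "bound_A1 N M n m a =
    a * sqrt (real m) / (sqrt 2 * (sqrt (ln (real n)) + sqrt (ln (real N - real n))))"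

definition bound_A2 :: "nat \<Rightarrow> nat \<Rightarrow> nat \<Rightarrow> nat \<Rightarrow> real \<Rightarrow> real" where
  "bound_A2 N M n m a =
    a * sqrt (real n) / (sqrt 2 * (sqrt (ln (real m)) + sqrt (ln (real M - real m))))"

definition bound_B :: "nat \<Rightarrow> nat \<Rightarrow> nat \<Rightarrow> nat \<Rightarrow> real \<Rightarrow> real" where
  "bound_B N M n m a = Min {bound_A1 N M n m a, bound_A2 N M n m a, bound_A N M n m a}"

text \<open>The double limit in which \<open>N\<close> and \<open>M\<close> tend to infinity independently of each other.\<close>

abbreviation NM_at_top :: "(nat \<times> nat) filter" where
  "NM_at_top \<equiv> sequentially \<times>\<^sub>F sequentially"

end

theory Submission
  imports Defs "HOL-Real_Asymp.Real_Asymp"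
begin

text \<open>
  The minimax error dominates the Bayes error for the uniform prior on any finite family of flat
  signals (constant \<open>a\<close> on a submatrix, zero elsewhere), so for each of the three ways in which
  \<open>bound_B < c < 1\<close> can happen it suffices to exhibit a family on which every selector
  succeeds with average probability tending to 0. Everything rests on the likelihood ratio of the
  observation against pure noise, which for a flat signal on \<open>C\<close> is
  \<open>exp (a * X - a\<^sup>2 * card C / 2)\<close> with \<open>X\<close> the sum of the observed entries over \<open>C\<close>.

  If \<open>bound_A < c\<close>, there are too many submatrices. The family is all of them; there are at least
  \<open>exp H\<close> with \<open>H = n ln (N/n) + m ln (M/m)\<close>. Under the true law the logarithm of the likelihood
  ratio is Gaussian with mean \<open>a\<^sup>2 n m / 2 < c\<^sup>2 H\<close> and standard deviation of order at most
  \<open>sqrt H\<close>, so it exceeds \<open>c H\<close> only with vanishing probability. Where it does not, the true law is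
  at most \<open>exp (c H)\<close> times the noise law, under which the disjoint events of selecting \<open>C\<close> have total
  probability at most 1; the average success is thus \<open>o(1) + exp (c H - H)\<close>. Bounding the tail of
  the likelihood ratio, in place of its mean as in Fano's inequality, is what drives the error to 1
  and not merely away from 0 (\<open>minimax_error_ge_entropy\<close>).

  If \<open>bound_A1 < c\<close>, the rows cannot be told apart even when the columns are known. The family fixes
  the column set and lets the row set \<open>A\<close> vary. The Bayes rule is maximum likelihood, and it can
  only be right if every row sum inside \<open>A\<close> is at least every row sum outside. Given a threshold,
  either all \<open>N - n\<close> sums outside lie below it or all \<open>n\<close> sums inside lie above it. In units of
  the standard deviation of a row sum, the threshold \<open>c sqrt (2 ln (N - n))\<close> is a factor \<open>c\<close> below
  the typical maximum of the outside sums, and \<open>bound_A1 < c\<close> says that the inside sums are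
  centred at most \<open>c sqrt (2 ln n)\<close> above it, so both events have vanishing probability
  (\<open>block_rate_tendsto_0\<close>). The case of \<open>bound_A2\<close> is the same with rows and columns exchanged;
  \<open>minimax_error_ge_blocks\<close> treats both by speaking of disjoint blocks of entries.
\<close>

section \<open>The likelihood ratio against pure noise\<close>

text \<open>Both sides give a box the same mass, because the integral of a product of functions of separate
  coordinates factorises.\<close>

lemma PiM_density:
  fixes M :: "'i \<Rightarrow> 'a measure" and f :: "'i \<Rightarrow> 'a \<Rightarrow> ennreal"
  assumes "finite I" and "\<And>i. sigma_finite_measure (M i)"
    and "\<And>i. sigma_finite_measure (density (M i) (f i))"
    and f[measurable]: "\<And>i. f i \<in> borel_measurable (M i)"
  shows "density (PiM I M) (\<lambda>x. \<Prod>i\<in>I. f i (x i)) = PiM I (\<lambda>i. density (M i) (f i))"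
proof -
  interpret P: product_sigma_finite M using assms(2) by (simp add: product_sigma_finite_def)
  interpret Q: product_sigma_finite "\<lambda>i. density (M i) (f i)"
    using assms(3) by (simp add: product_sigma_finite_def)
  have [measurable]: "(\<lambda>x. \<Prod>i\<in>I. f i (x i)) \<in> borel_measurable (PiM I M)"
    by (intro borel_measurable_prod_ennreal) measurable
  show ?thesis
  proof (rule Q.PiM_eqI)
    fix A assume A: "\<And>i. i \<in> I \<Longrightarrow> A i \<in> sets (density (M i) (f i))"
    then have A'[measurable]: "\<And>i. i \<in> I \<Longrightarrow> A i \<in> sets (M i)" by simp
    define B where "B i = (if i \<in> I then A i else {})" for i
    have [measurable]: "B i \<in> sets (M i)" for i using A' by (simp add: B_def)
    have "emeasure (density (PiM I M) (\<lambda>x. \<Prod>i\<in>I. f i (x i))) (Pi\<^sub>E I A)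
        = (\<integral>\<^sup>+x. (\<Prod>i\<in>I. f i (x i)) * indicator (Pi\<^sub>E I A) x \<partial>PiM I M)"
      using A' assms(1) by (intro emeasure_density) (auto intro!: sets_PiM_I_finite)
    also have "\<dots> = (\<integral>\<^sup>+x. (\<Prod>i\<in>I. f i (x i) * indicator (B i) (x i)) \<partial>PiM I M)"
    proof (rule nn_integral_cong)
      fix x assume x: "x \<in> space (PiM I M)"
      have "indicator (Pi\<^sub>E I A) x = (\<Prod>i\<in>I. indicator (B i) (x i) :: ennreal)"
      proof (cases "\<forall>i\<in>I. x i \<in> A i")
        case True
        then show ?thesis using x by (auto simp: space_PiM PiE_iff B_def)
      next
        case False
        then obtain j where "j \<in> I" "x j \<notin> A j" by auto
        then have "(\<Prod>i\<in>I. indicator (B i) (x i) :: ennreal) = 0"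
          using assms(1) by (intro prod_zero bexI[of _ j]) (auto simp: B_def)
        with False show ?thesis by (auto simp: PiE_iff)
      qed
      then show "(\<Prod>i\<in>I. f i (x i)) * indicator (Pi\<^sub>E I A) x
          = (\<Prod>i\<in>I. f i (x i) * indicator (B i) (x i))"
        by (simp add: prod.distrib)
    qed
    also have "\<dots> = (\<Prod>i\<in>I. \<integral>\<^sup>+x. f i x * indicator (B i) x \<partial>M i)"
      using assms(1) by (intro P.product_nn_integral_prod) auto
    also have "\<dots> = (\<Prod>i\<in>I. emeasure (density (M i) (f i)) (A i))"
      using A' by (intro prod.cong refl, subst emeasure_density) (auto simp: B_def)
    finally show "emeasure (density (PiM I M) (\<lambda>x. \<Prod>i\<in>I. f i (x i))) (Pi\<^sub>E I A)
        = (\<Prod>i\<in>I. emeasure (density (M i) (f i)) (A i))" .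
  qed (auto simp: assms(1) intro!: sets_PiM_cong)
qed

lemma std_normal_shift:
  fixes s :: real
  shows "distr std_normal_distribution borel (\<lambda>x. s + x)
       = density std_normal_distribution (\<lambda>x. ennreal (exp (s * x - s\<^sup>2 / 2)))"
proof (rule measure_eqI)
  fix A :: "real set"
  assume "A \<in> sets (distr std_normal_distribution borel (\<lambda>x. s + x))"
  then have A[measurable]: "A \<in> sets borel" by simp
  have "(\<lambda>x. s + x) -` A \<in> sets borel"
    using measurable_sets_borel[OF _ A, of "\<lambda>x. s + x"] by simp
  note [measurable] = this
  have *: "std_normal_density (s + x) * exp (s * (s + x) - s\<^sup>2 / 2) = std_normal_density x" for x
    unfolding std_normal_density_def
    by (simp add: mult_exp_exp[symmetric] power2_eq_square field_simps flip: exp_add)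
  have "emeasure (density std_normal_distribution (\<lambda>x. ennreal (exp (s * x - s\<^sup>2 / 2)))) A
      = (\<integral>\<^sup>+x. ennreal (std_normal_density x * exp (s * x - s\<^sup>2 / 2)) * indicator A x \<partial>lborel)"
    by (simp add: emeasure_density nn_integral_density ennreal_mult' mult.assoc)
  also have "\<dots> = (\<integral>\<^sup>+x. ennreal (std_normal_density x) * indicator A (s + x) \<partial>lborel)"
    by (subst nn_integral_real_affine[where c = 1 and t = s]) (simp_all add: *)
  also have "\<dots> = emeasure (distr std_normal_distribution borel (\<lambda>x. s + x)) A"
    by (simp add: emeasure_distr emeasure_density)
      (auto simp: indicator_def intro!: nn_integral_cong)
  finally show "emeasure (distr std_normal_distribution borel (\<lambda>x. s + x)) A
      = emeasure (density std_normal_distribution (\<lambda>x. ennreal (exp (s * x - s\<^sup>2 / 2)))) A" ..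
qed simp

lemma finite_entries [simp]: "finite (entries N M)"
  by (simp add: entries_def)

lemma prob_space_std_normal: "prob_space std_normal_distribution"
  by (rule prob_space_normal_density) simp

lemma prob_space_noise_law: "prob_space (noise_law N M)"
  unfolding noise_law_def by (intro prob_space_PiM prob_space_std_normal)

lemma sets_noise_law [measurable_cong]: "sets (noise_law N M) = sets (matrix_space N M)"
  unfolding noise_law_def matrix_space_def by (intro sets_PiM_cong) auto

lemma space_noise_law: "space (noise_law N M) = space (matrix_space N M)"
  by (rule sets_eq_imp_space_eq[OF sets_noise_law])

lemma measurable_entry [measurable]:
  "e \<in> entries N M \<Longrightarrow> (\<lambda>y. y e) \<in> borel_measurable (matrix_space N M)"
  unfolding matrix_space_def by measurable

lemma measurable_shift [measurable]:
  "(\<lambda>\<xi>. \<lambda>e\<in>entries N M. s e + \<xi> e) \<in> measurable (matrix_space N M) (matrix_space N M)"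
  unfolding matrix_space_def by measurable

lemma sets_obs_law [measurable_cong, simp]: "sets (obs_law N M s) = sets (matrix_space N M)"
  unfolding obs_law_def by simp

lemma space_obs_law [simp]: "space (obs_law N M s) = space (matrix_space N M)"
  unfolding obs_law_def by simp

lemma prob_space_obs_law: "prob_space (obs_law N M s)"
  unfolding obs_law_def
  by (rule prob_space.prob_space_distr[OF prob_space_noise_law]) measurable

text \<open>The density of the law with mean matrix \<open>s\<close> with respect to the law of the pure noise.\<close>

definition likelihood :: "nat \<Rightarrow> nat \<Rightarrow> (nat \<times> nat \<Rightarrow> real) \<Rightarrow> (nat \<times> nat \<Rightarrow> real) \<Rightarrow> real" where
  "likelihood N M s y = exp (\<Sum>e\<in>entries N M. s e * y e - (s e)\<^sup>2 / 2)"

lemma measurable_likelihood [measurable]: "likelihood N M s \<in> borel_measurable (matrix_space N M)"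
  unfolding likelihood_def by measurable

lemma obs_law_eq_density:
  "obs_law N M s = density (noise_law N M) (\<lambda>y. ennreal (likelihood N M s y))"
proof -
  let ?E = "entries N M" and ?G = "std_normal_distribution"
  let ?D = "\<lambda>e. distr ?G borel (\<lambda>x. s e + x)"
  interpret Q: product_sigma_finite ?D
    unfolding product_sigma_finite_def
    by (intro allI prob_space_imp_sigma_finite prob_space.prob_space_distr[OF prob_space_std_normal])
      simp
  interpret G: product_sigma_finite "\<lambda>_::nat\<times>nat. ?G"
    unfolding product_sigma_finite_def
    by (intro allI prob_space_imp_sigma_finite prob_space_std_normal)
  have "obs_law N M s = PiM ?E ?D"
  proof (rule Q.PiM_eqI)
    fix A assume "\<And>i. i \<in> ?E \<Longrightarrow> A i \<in> sets (?D i)"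
    then have A: "\<And>i. i \<in> ?E \<Longrightarrow> A i \<in> sets borel" by simp
    then have PA: "Pi\<^sub>E ?E A \<in> sets (matrix_space N M)"
      unfolding matrix_space_def by (intro sets_PiM_I_finite) auto
    have "emeasure (obs_law N M s) (Pi\<^sub>E ?E A)
        = emeasure (noise_law N M)
            ((\<lambda>\<xi>. \<lambda>e\<in>?E. s e + \<xi> e) -` Pi\<^sub>E ?E A \<inter> space (noise_law N M))"
      unfolding obs_law_def using PA by (intro emeasure_distr) auto
    also have "(\<lambda>\<xi>. \<lambda>e\<in>?E. s e + \<xi> e) -` Pi\<^sub>E ?E A \<inter> space (noise_law N M)
        = Pi\<^sub>E ?E (\<lambda>e. (\<lambda>x. s e + x) -` A e)"
      by (auto simp: noise_law_def space_PiM PiE_iff)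
    also have "emeasure (noise_law N M) \<dots> = (\<Prod>e\<in>?E. emeasure ?G ((\<lambda>x. s e + x) -` A e))"
      unfolding noise_law_def
    proof (rule G.emeasure_PiM)
      fix i assume i: "i \<in> ?E"
      have "(\<lambda>x. s i + x) \<in> borel_measurable borel" by simp
      from measurable_sets[OF this A[OF i]] show "(\<lambda>x. s i + x) -` A i \<in> sets ?G" by simp
    qed simp
    also have "\<dots> = (\<Prod>e\<in>?E. emeasure (?D e) (A e))"
      using A by (intro prod.cong refl) (simp add: emeasure_distr)
    finally show "emeasure (obs_law N M s) (Pi\<^sub>E ?E A) = (\<Prod>e\<in>?E. emeasure (?D e) (A e))" .
  qed (auto simp: matrix_space_def intro!: sets_PiM_cong)
  also have "\<dots> = PiM ?E (\<lambda>e. density ?G (\<lambda>x. ennreal (exp (s e * x - (s e)\<^sup>2 / 2))))"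
    by (simp add: std_normal_shift)
  also have "\<dots> = density (PiM ?E (\<lambda>_. ?G)) (\<lambda>y. \<Prod>e\<in>?E. ennreal (exp (s e * y e - (s e)\<^sup>2 / 2)))"
    by (rule PiM_density[symmetric])
      (auto simp flip: std_normal_shift intro!: prob_space_imp_sigma_finite
        prob_space.prob_space_distr[OF prob_space_std_normal] prob_space_std_normal)
  finally show ?thesis
    by (simp add: noise_law_def likelihood_def exp_sum prod_ennreal)
qed

section \<open>Bayes risk\<close>

text \<open>The signals that carry the priors: their nonzero entries sit at the smallest level that the
  class admits.\<close>

definition flat_signal :: "nat \<Rightarrow> nat \<Rightarrow> real \<Rightarrow> (nat \<times> nat) set \<Rightarrow> nat \<times> nat \<Rightarrow> real" where
  "flat_signal N M a C = (\<lambda>e\<in>entries N M. if e \<in> C then a else 0)"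

lemma submatrices_subset_entries: "C \<in> submatrices N M n m \<Longrightarrow> C \<subseteq> entries N M"
  by (auto simp: submatrices_def entries_def)

lemma times_in_submatrices:
  "A \<subseteq> {1..N} \<Longrightarrow> B \<subseteq> {1..M} \<Longrightarrow> card A = n \<Longrightarrow> card B = m \<Longrightarrow> A \<times> B \<in> submatrices N M n m"
  unfolding submatrices_def by blast

lemma finite_submatrices: "finite (submatrices N M n m)"
  by (rule finite_subset[of _ "Pow (entries N M)"]) (auto dest: submatrices_subset_entries)

lemma flat_signal_in_signals:
  assumes "C \<in> submatrices N M n m"
  shows "flat_signal N M a C \<in> signals N M n m a"
  using assms submatrices_subset_entries[OF assms]
  by (auto simp: signals_def flat_signal_def intro!: bexI[of _ C])

lemma support_flat_signal:
  assumes "C \<subseteq> entries N M" "a > 0"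
  shows "support N M (flat_signal N M a C) = C"
  using assms by (auto simp: support_def flat_signal_def)

lemma selector_events:
  assumes "Chat \<in> selectors N M n m" "C \<in> submatrices N M n m"
  shows "{Y \<in> space (matrix_space N M). Chat Y = C} \<in> sets (matrix_space N M)"
proof -
  have "Chat -` {C} \<inter> space (matrix_space N M) \<in> sets (matrix_space N M)"
    using assms by (intro measurable_sets[of Chat _ "count_space (submatrices N M n m)"])
      (auto simp: selectors_def)
  also have "Chat -` {C} \<inter> space (matrix_space N M) = {Y \<in> space (matrix_space N M). Chat Y = C}"
    by auto
  finally show ?thesis .
qed

lemma minimax_error_le_1:
  assumes "submatrices N M n m \<noteq> {}"
  shows "minimax_error N M n m a \<le> 1"
proof -
  obtain C where C: "C \<in> submatrices N M n m" using assms by auto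
  have sig: "signals N M n m a \<noteq> {}" using flat_signal_in_signals[OF C] by auto
  have sel: "(\<lambda>_. C) \<in> selectors N M n m" using C by (simp add: selectors_def)
  have le1: "measure (obs_law N M s) E \<le> 1" for s E
    using prob_space.prob_le_1[OF prob_space_obs_law] .
  have s_le: "(SUP s\<in>signals N M n m a. measure (obs_law N M s) (E s)) \<le> 1" for E
    using sig le1 by (intro cSUP_least) auto
  have s_ge: "0 \<le> (SUP s\<in>signals N M n m a. measure (obs_law N M s) (E s))" for E
  proof -
    have "0 \<le> measure (obs_law N M (flat_signal N M a C)) (E (flat_signal N M a C))" by simp
    also have "\<dots> \<le> (SUP s\<in>signals N M n m a. measure (obs_law N M s) (E s))"
      by (rule cSUP_upper[OF flat_signal_in_signals[OF C]]) (auto intro!: bdd_aboveI2 le1)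
    finally show ?thesis .
  qed
  show ?thesis unfolding minimax_error_def
    by (rule cINF_lower2[OF _ sel s_le]) (auto intro!: bdd_belowI2 s_ge)
qed

text \<open>The largest error over the class is at least the average error over a subfamily, and the error averages to 1 minus the average success.\<close>

lemma minimax_error_ge_bayes:
  fixes r :: real
  assumes D: "D \<subseteq> submatrices N M n m" "D \<noteq> {}" and a: "a > 0"
    and succ: "\<And>Chat. Chat \<in> selectors N M n m \<Longrightarrow>
      (\<Sum>C\<in>D. measure (obs_law N M (flat_signal N M a C))
               {Y \<in> space (matrix_space N M). Chat Y = C}) \<le> r * card D"
  shows "minimax_error N M n m a \<ge> 1 - r"
proof -
  have finD: "finite D" using D(1) finite_submatrices finite_subset by blast
  have cardD: "real (card D) > 0" using finD D(2) by (simp add: card_gt_0_iff)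
  obtain C where C: "C \<in> submatrices N M n m" using D by auto
  have sel: "(\<lambda>_. C) \<in> selectors N M n m" using C by (simp add: selectors_def)
  show ?thesis unfolding minimax_error_def
  proof (rule cINF_greatest)
    show "selectors N M n m \<noteq> {}" using sel by auto
    fix Chat assume Chat: "Chat \<in> selectors N M n m"
    let ?err = "\<lambda>s. measure (obs_law N M s) {Y \<in> space (matrix_space N M). Chat Y \<noteq> support N M s}"
    let ?S = "SUP s\<in>signals N M n m a. ?err s"
    have up: "1 - measure (obs_law N M (flat_signal N M a C))
        {Y \<in> space (matrix_space N M). Chat Y = C} \<le> ?S" if "C \<in> D" for C
    proof -
      have C: "C \<in> submatrices N M n m" using that D by auto
      let ?s = "flat_signal N M a C"
      interpret prob_space "obs_law N M ?s" by (rule prob_space_obs_law)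
      have "1 - prob {Y \<in> space (matrix_space N M). Chat Y = C}
          = prob (space (obs_law N M ?s) - {Y \<in> space (matrix_space N M). Chat Y = C})"
        using selector_events[OF Chat C] by (subst prob_compl) auto
      also have "\<dots> = ?err ?s"
        using support_flat_signal[OF submatrices_subset_entries[OF C] a]
        by (auto intro!: arg_cong[where f = "measure _"])
      also have "?err ?s \<le> ?S"
        by (rule cSUP_upper[OF flat_signal_in_signals[OF C]])
          (auto intro!: bdd_aboveI2[where M = 1] prob_space.prob_le_1[OF prob_space_obs_law])
      finally show ?thesis .
    qed
    have "(1 - r) * card D \<le> (\<Sum>C\<in>D. 1 - measure (obs_law N M (flat_signal N M a C))
        {Y \<in> space (matrix_space N M). Chat Y = C})"
      using succ[OF Chat] by (simp add: sum_subtractf algebra_simps)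
    also have "\<dots> \<le> card D * ?S" using sum_bounded_above[of D, OF up] by simp
    finally show "1 - r \<le> ?S" using cardD by (simp add: mult.commute)
  qed
qed

text \<open>A change of measure: off the event that the likelihood ratio exceeds \<open>exp t\<close>, the law of the
  observation is at most \<open>exp t\<close> times the law of pure noise. The events of selecting distinct \<open>C\<close> are
  disjoint, so their probabilities under the noise law, which does not depend on \<open>C\<close>, sum to at
  most 1.\<close>

lemma bayes_success_le_likelihood_tail:
  assumes D: "D \<subseteq> submatrices N M n m" and Chat: "Chat \<in> selectors N M n m"
  shows "(\<Sum>C\<in>D. measure (obs_law N M (s C)) {Y \<in> space (matrix_space N M). Chat Y = C})
    \<le> (\<Sum>C\<in>D. measure (obs_law N M (s C))
            {Y \<in> space (matrix_space N M). likelihood N M (s C) Y > exp t}) + exp t"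
proof -
  have finD: "finite D" using D finite_submatrices finite_subset by blast
  interpret P0: prob_space "noise_law N M" by (rule prob_space_noise_law)
  define E where "E C = {Y \<in> space (matrix_space N M). Chat Y = C}" for C
  have E[measurable]: "E C \<in> sets (matrix_space N M)" if "C \<in> D" for C
    unfolding E_def using selector_events[OF Chat] D that by blast
  let ?L = "\<lambda>C. {Y \<in> space (matrix_space N M). likelihood N M (s C) Y > exp t}"
  have one: "measure (obs_law N M (s C)) (E C)
      \<le> measure (obs_law N M (s C)) (?L C) + exp t * measure (noise_law N M) (E C)"
    if C: "C \<in> D" for C
  proof -
    interpret P: prob_space "obs_law N M (s C)" by (rule prob_space_obs_law)
    have [measurable]: "E C \<in> sets (matrix_space N M)" by (rule E[OF C])
    have "emeasure (obs_law N M (s C)) (E C - ?L C)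
        = (\<integral>\<^sup>+y. ennreal (likelihood N M (s C) y) * indicator (E C - ?L C) y \<partial>noise_law N M)"
      unfolding obs_law_eq_density by (intro emeasure_density) measurable
    also have "\<dots> \<le> (\<integral>\<^sup>+y. ennreal (exp t) * indicator (E C) y \<partial>noise_law N M)"
      by (intro nn_integral_mono) (auto simp: indicator_def E_def not_less intro!: ennreal_leI)
    also have "\<dots> = ennreal (exp t) * emeasure (noise_law N M) (E C)"
      by (intro nn_integral_cmult_indicator) measurable
    finally have "measure (obs_law N M (s C)) (E C - ?L C)
        \<le> exp t * measure (noise_law N M) (E C)"
      by (simp add: P.emeasure_eq_measure P0.emeasure_eq_measure flip: ennreal_mult)
    moreover have "measure (obs_law N M (s C)) (E C)
        \<le> measure (obs_law N M (s C)) (?L C \<union> (E C - ?L C))"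
      by (intro P.finite_measure_mono) auto
    moreover have "\<dots> \<le> measure (obs_law N M (s C)) (?L C) + measure (obs_law N M (s C)) (E C - ?L C)"
      by (intro measure_Un_le) auto
    ultimately show ?thesis by linarith
  qed
  have "(\<Sum>C\<in>D. measure (noise_law N M) (E C)) = measure (noise_law N M) (\<Union>C\<in>D. E C)"
    using E by (intro P0.finite_measure_finite_Union[symmetric] finD)
      (auto simp: disjoint_family_on_def E_def sets_noise_law)
  also have "\<dots> \<le> 1" by simp
  finally have "exp t * (\<Sum>C\<in>D. measure (noise_law N M) (E C)) \<le> exp t"
    by simp
  moreover have "(\<Sum>C\<in>D. measure (obs_law N M (s C)) (E C))
      \<le> (\<Sum>C\<in>D. measure (obs_law N M (s C)) (?L C) + exp t * measure (noise_law N M) (E C))"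
    by (rule sum_mono) (rule one)
  ultimately show ?thesis
    by (simp add: sum.distrib sum_distrib_left E_def)
qed

text \<open>Summed over \<open>C\<close>, the densities restricted to the events of selecting \<open>C\<close> contribute at each
  point a single likelihood, at most the largest one; that one is attained at some \<open>C\<close> and so
  is counted on the right. Ties only enlarge the right-hand side.\<close>

lemma bayes_success_le_maximum_likelihood:
  assumes D: "D \<subseteq> submatrices N M n m" and Chat: "Chat \<in> selectors N M n m"
  shows "(\<Sum>C\<in>D. measure (obs_law N M (s C)) {Y \<in> space (matrix_space N M). Chat Y = C})
    \<le> (\<Sum>C\<in>D. measure (obs_law N M (s C))
            {Y \<in> space (matrix_space N M). \<forall>C'\<in>D. likelihood N M (s C') Y \<le> likelihood N M (s C) Y})"
proof -
  have finD: "finite D" using D finite_submatrices finite_subset by blast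
  define E where "E C = {Y \<in> space (matrix_space N M). Chat Y = C}" for C
  define B where "B C = {Y \<in> space (matrix_space N M).
      \<forall>C'\<in>D. likelihood N M (s C') Y \<le> likelihood N M (s C) Y}" for C
  have E: "E C \<in> sets (matrix_space N M)" if "C \<in> D" for C
    unfolding E_def using selector_events[OF Chat] D that by blast
  have B: "B C \<in> sets (matrix_space N M)" for C
  proof -
    have "{Y \<in> space (matrix_space N M). likelihood N M (s C') Y \<le> likelihood N M (s C) Y}
        \<in> sets (matrix_space N M)" for C' by measurable
    then show ?thesis unfolding B_def by (intro sets.sets_Collect_finite_All finD)
  qed
  let ?l = "\<lambda>C y. ennreal (likelihood N M (s C) y)"
  have dens: "(\<Sum>C\<in>D. emeasure (obs_law N M (s C)) (F C))
      = (\<integral>\<^sup>+y. (\<Sum>C\<in>D. ?l C y * indicator (F C) y) \<partial>noise_law N M)"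
    if F: "\<And>C. C \<in> D \<Longrightarrow> F C \<in> sets (matrix_space N M)" for F
  proof -
    have "(\<lambda>y. ?l C y * indicator (F C) y) \<in> borel_measurable (noise_law N M)" if "C \<in> D" for C
    proof -
      have [measurable]: "F C \<in> sets (matrix_space N M)" using F that .
      show ?thesis by measurable
    qed
    then have "(\<integral>\<^sup>+y. (\<Sum>C\<in>D. ?l C y * indicator (F C) y) \<partial>noise_law N M)
        = (\<Sum>C\<in>D. \<integral>\<^sup>+y. ?l C y * indicator (F C) y \<partial>noise_law N M)"
      by (rule nn_integral_sum)
    also have "\<dots> = (\<Sum>C\<in>D. emeasure (obs_law N M (s C)) (F C))"
      unfolding obs_law_eq_density using F
      by (intro sum.cong refl emeasure_density[symmetric]) (measurable, simp add: sets_noise_law)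
    finally show ?thesis ..
  qed
  have dens_E: "(\<Sum>C\<in>D. emeasure (obs_law N M (s C)) (E C))
      = (\<integral>\<^sup>+y. (\<Sum>C\<in>D. ?l C y * indicator (E C) y) \<partial>noise_law N M)"
    by (rule dens) (rule E)
  have "(\<Sum>C\<in>D. emeasure (obs_law N M (s C)) (E C))
      \<le> (\<Sum>C\<in>D. emeasure (obs_law N M (s C)) (B C))"
    unfolding dens_E dens[of B, OF B]
  proof (rule nn_integral_mono)
    fix y assume "y \<in> space (noise_law N M)"
    then have y: "y \<in> space (matrix_space N M)" by (simp add: space_noise_law)
    show "(\<Sum>C\<in>D. ?l C y * indicator (E C) y) \<le> (\<Sum>C\<in>D. ?l C y * indicator (B C) y)"
    proof (cases "Chat y \<in> D")
      case True
      have "Max ((\<lambda>C. likelihood N M (s C) y) ` D) \<in> (\<lambda>C. likelihood N M (s C) y) ` D"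
        using finD True by (intro Max_in) auto
      then obtain C where C: "C \<in> D" "likelihood N M (s C) y = Max ((\<lambda>C. likelihood N M (s C) y) ` D)"
        by auto
      have C_max: "likelihood N M (s C') y \<le> likelihood N M (s C) y" if "C' \<in> D" for C'
        unfolding C(2) using finD that by (intro Max_ge) auto
      have "(\<Sum>C\<in>D. ?l C y * indicator (E C) y) = (\<Sum>C\<in>D. if C = Chat y then ?l C y else 0)"
        using y by (intro sum.cong) (auto simp: E_def)
      also have "\<dots> = ?l (Chat y) y" using finD True by simp
      also have "\<dots> \<le> ?l C y" using C_max True by (intro ennreal_leI) auto
      also have "\<dots> = ?l C y * indicator (B C) y" using C_max y by (auto simp: B_def)
      also have "\<dots> \<le> (\<Sum>C\<in>D. ?l C y * indicator (B C) y)"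
        using finD C by (intro member_le_sum) auto
      finally show ?thesis .
    next
      case False
      then have "(\<Sum>C\<in>D. ?l C y * indicator (E C) y) = 0"
        by (intro sum.neutral) (auto simp: E_def split: split_indicator)
      then show ?thesis by simp
    qed
  qed
  moreover have fin: "emeasure (obs_law N M (s C)) F = ennreal (measure (obs_law N M (s C)) F)" for C F
    using prob_space_obs_law
    by (intro finite_measure.emeasure_eq_measure prob_space.axioms(1)[OF prob_space_obs_law])
  ultimately have "ennreal (\<Sum>C\<in>D. measure (obs_law N M (s C)) (E C))
      \<le> ennreal (\<Sum>C\<in>D. measure (obs_law N M (s C)) (B C))"
    by (simp add: fin sum_ennreal)
  then show ?thesis
    by (simp add: E_def B_def sum_nonneg)
qed

section \<open>Sums of noise over blocks of entries\<close>

definition Phi :: "real \<Rightarrow> real" where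
  "Phi = cdf std_normal_distribution"

lemma Phi_nonneg: "0 \<le> Phi x"
  by (simp add: Phi_def cdf_def)

lemma Phi_le_1: "Phi x \<le> 1"
  unfolding Phi_def cdf_def by (rule prob_space.prob_le_1[OF prob_space_std_normal])

lemma Phi_mono: "x \<le> y \<Longrightarrow> Phi x \<le> Phi y"
  unfolding Phi_def
  by (intro finite_borel_measure.cdf_nondecreasing real_distribution.finite_borel_measure_M
      real_dist_normal_dist)

lemma Phi_at_top: "(Phi \<longlongrightarrow> 1) at_top"
  unfolding Phi_def by (rule real_distribution.cdf_lim_at_top_prob[OF real_dist_normal_dist])

lemma distr_noise_entry:
  assumes e: "e \<in> entries N M" and S: "sets S = sets borel"
  shows "distr (noise_law N M) S (\<lambda>\<xi>. \<xi> e) = std_normal_distribution"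
proof -
  have "distr (noise_law N M) S (\<lambda>\<xi>. \<xi> e)
      = distr (noise_law N M) std_normal_distribution (\<lambda>\<xi>. \<xi> e)"
    using S by (intro distr_cong) auto
  also have "\<dots> = std_normal_distribution"
    unfolding noise_law_def by (rule distr_PiM_component[OF prob_space_std_normal e])
  finally show ?thesis .
qed

lemma indep_vars_noise_entries:
  assumes "E \<subseteq> entries N M"
  shows "prob_space.indep_vars (noise_law N M) (\<lambda>_. borel) (\<lambda>e \<xi>. \<xi> e) E"
proof (cases "E = {}")
  case True
  interpret prob_space "noise_law N M" by (rule prob_space_noise_law)
  show ?thesis using True by (simp add: indep_vars_def indep_sets_def)
next
  case False
  interpret prob_space "noise_law N M" by (rule prob_space_noise_law)
  have "indep_vars (\<lambda>_. borel) (\<lambda>e \<xi>. \<xi> e) (entries N M)"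
  proof (subst indep_vars_iff_distr_eq_PiM')
    show "entries N M \<noteq> {}" using False assms by auto
    have "distr (noise_law N M) (PiM (entries N M) (\<lambda>_. borel)) (\<lambda>x. \<lambda>e\<in>entries N M. x e)
        = distr (noise_law N M) (noise_law N M) (\<lambda>x. x)"
    proof (rule distr_cong)
      show "sets (PiM (entries N M) (\<lambda>_. borel)) = sets (noise_law N M)"
        by (simp add: sets_noise_law matrix_space_def)
      fix x assume "x \<in> space (noise_law N M)"
      then show "(\<lambda>e\<in>entries N M. x e) = x"
        by (auto simp: noise_law_def space_PiM intro: PiE_restrict)
    qed simp
    also have "\<dots> = PiM (entries N M) (\<lambda>_. std_normal_distribution)"
      by (simp add: noise_law_def)
    also have "\<dots> = PiM (entries N M) (\<lambda>e. distr (noise_law N M) borel (\<lambda>\<xi>. \<xi> e))"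
      by (intro PiM_cong) (simp_all add: distr_noise_entry)
    finally show "distr (noise_law N M) (PiM (entries N M) (\<lambda>_. borel)) (\<lambda>x. \<lambda>e\<in>entries N M. x e)
        = PiM (entries N M) (\<lambda>e. distr (noise_law N M) borel (\<lambda>\<xi>. \<xi> e))" .
  qed measurable
  then show ?thesis by (rule indep_vars_subset) (rule assms)
qed

lemma distributed_noise_entry:
  assumes e: "e \<in> entries N M"
  shows "distributed (noise_law N M) lborel (\<lambda>\<xi>. \<xi> e) std_normal_density"
  unfolding distributed_def
proof (intro conjI)
  show "distr (noise_law N M) lborel (\<lambda>\<xi>. \<xi> e)
      = density lborel (\<lambda>x. ennreal (std_normal_density x))"
    using e by (rule distr_noise_entry) simp
  show "(\<lambda>\<xi>. \<xi> e) \<in> noise_law N M \<rightarrow>\<^sub>M lborel" using e by measurable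
qed simp

text \<open>The sign \<open>c\<close> makes one statement serve for lower and upper tails of a sum, by the symmetry of
  the Gaussian law.\<close>

lemma prob_noise_block_sum_le:
  assumes B: "B \<subseteq> entries N M" "B \<noteq> {}" and c: "\<bar>c\<bar> = 1"
  shows "measure (noise_law N M)
      {\<xi> \<in> space (noise_law N M). c * (\<Sum>e\<in>B. \<xi> e) \<le> x * sqrt (card B)} = Phi x"
proof -
  interpret prob_space "noise_law N M" by (rule prob_space_noise_law)
  have finB: "finite B" using B(1) finite_entries finite_subset by blast
  then have pos: "sqrt (card B) > 0" using B(2) by (simp add: card_gt_0_iff)
  have "distributed (noise_law N M) lborel (\<lambda>\<xi>. \<Sum>e\<in>B. \<xi> e)
      (normal_density (\<Sum>e\<in>B. 0) (sqrt (\<Sum>e\<in>B. 1\<^sup>2)))"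
    using B finB
    by (intro sum_indep_normal indep_vars_noise_entries distributed_noise_entry) auto
  then have "distributed (noise_law N M) lborel (\<lambda>\<xi>. \<Sum>e\<in>B. \<xi> e) (normal_density 0 (sqrt (card B)))"
    by simp
  from normal_density_affine[OF this pos, of "c / sqrt (card B)" 0]
  have *: "distributed (noise_law N M) lborel (\<lambda>\<xi>. c * (\<Sum>e\<in>B. \<xi> e) / sqrt (card B))
      std_normal_density"
    using c pos by auto
  have meas: "(\<lambda>\<xi>. c * (\<Sum>e\<in>B. \<xi> e) / sqrt (card B)) \<in> noise_law N M \<rightarrow>\<^sub>M lborel"
    using * by (rule distributed_measurable)
  have "Phi x = measure (distr (noise_law N M) lborel (\<lambda>\<xi>. c * (\<Sum>e\<in>B. \<xi> e) / sqrt (card B))) {..x}"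
    by (simp add: Phi_def cdf_def distributed_distr_eq_density[OF *])
  also have "\<dots> = measure (noise_law N M)
      ((\<lambda>\<xi>. c * (\<Sum>e\<in>B. \<xi> e) / sqrt (card B)) -` {..x} \<inter> space (noise_law N M))"
    by (rule measure_distr[OF meas]) simp
  also have "(\<lambda>\<xi>. c * (\<Sum>e\<in>B. \<xi> e) / sqrt (card B)) -` {..x} \<inter> space (noise_law N M)
      = {\<xi> \<in> space (noise_law N M). c * (\<Sum>e\<in>B. \<xi> e) \<le> x * sqrt (card B)}"
    using pos by (auto simp: divide_le_eq)
  finally show ?thesis ..
qed

lemma prob_all_noise_block_sums_le:
  assumes A: "finite A" and B: "\<And>i. i \<in> A \<Longrightarrow> B i \<subseteq> entries N M" "\<And>i. i \<in> A \<Longrightarrow> card (B i) = m"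
    and disj: "disjoint_family_on B A" and m: "m > 0" and c: "\<bar>c\<bar> = 1"
  shows "measure (noise_law N M)
      {\<xi> \<in> space (noise_law N M). \<forall>i\<in>A. c * (\<Sum>e\<in>B i. \<xi> e) \<le> x * sqrt m} = Phi x ^ card A"
proof (cases "A = {}")
  case True
  then show ?thesis using prob_space.prob_space[OF prob_space_noise_law, of N M] by simp
next
  case False
  interpret prob_space "noise_law N M" by (rule prob_space_noise_law)
  have "indep_vars (\<lambda>i. PiM (B i) (\<lambda>_. borel)) (\<lambda>i \<xi>. restrict (\<lambda>e. \<xi> e) (B i)) A"
    using B(1) disj by (intro indep_vars_restrict[OF indep_vars_noise_entries[of "entries N M"]]) auto
  from indep_vars_compose2[OF this, of "\<lambda>i y. c * (\<Sum>e\<in>B i. y e)" "\<lambda>_. borel"]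
  have "indep_vars (\<lambda>_. borel) (\<lambda>i \<xi>. c * (\<Sum>e\<in>B i. restrict \<xi> (B i) e)) A"
    by simp
  then have ind: "indep_vars (\<lambda>_. borel) (\<lambda>i \<xi>. c * (\<Sum>e\<in>B i. \<xi> e)) A"
    by simp
  have "{\<xi> \<in> space (noise_law N M). \<forall>i\<in>A. c * (\<Sum>e\<in>B i. \<xi> e) \<le> x * sqrt m}
      = (\<Inter>i\<in>A. (\<lambda>\<xi>. c * (\<Sum>e\<in>B i. \<xi> e)) -` {..x * sqrt m} \<inter> space (noise_law N M))"
    using False by auto
  also have "prob \<dots> = (\<Prod>i\<in>A. prob ((\<lambda>\<xi>. c * (\<Sum>e\<in>B i. \<xi> e)) -` {..x * sqrt m} \<inter> space (noise_law N M)))"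
    using False A by (intro indep_varsD_finite[OF ind]) auto
  also have "\<dots> = (\<Prod>i\<in>A. Phi x)"
  proof (rule prod.cong)
    fix i assume i: "i \<in> A"
    have "B i \<noteq> {}" using B(2)[OF i] m by auto
    from prob_noise_block_sum_le[OF B(1)[OF i] this c, of x]
    show "prob ((\<lambda>\<xi>. c * (\<Sum>e\<in>B i. \<xi> e)) -` {..x * sqrt m} \<inter> space (noise_law N M)) = Phi x"
      by (simp add: B(2)[OF i] vimage_def Int_def conj_commute)
  qed simp
  finally show ?thesis by simp
qed

section \<open>Lower bounds for a fixed size\<close>

lemma measure_obs_law:
  assumes "E \<in> sets (matrix_space N M)"
  shows "measure (obs_law N M s) E
    = measure (noise_law N M) {\<xi> \<in> space (noise_law N M). (\<lambda>e\<in>entries N M. s e + \<xi> e) \<in> E}"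
proof -
  have "measure (obs_law N M s) E
      = measure (noise_law N M) ((\<lambda>\<xi>. \<lambda>e\<in>entries N M. s e + \<xi> e) -` E \<inter> space (noise_law N M))"
    unfolding obs_law_def by (rule measure_distr) (use assms in measurable)
  then show ?thesis by (simp add: vimage_def Int_def conj_commute)
qed

lemma likelihood_flat_signal:
  assumes C: "C \<subseteq> entries N M"
  shows "likelihood N M (flat_signal N M a C) y = exp (a * (\<Sum>e\<in>C. y e) - a\<^sup>2 * card C / 2)"
proof -
  have "(\<Sum>e\<in>entries N M. flat_signal N M a C e * y e - (flat_signal N M a C e)\<^sup>2 / 2)
      = (\<Sum>e\<in>entries N M. if e \<in> C then a * y e - a\<^sup>2 / 2 else 0)"
    by (intro sum.cong) (auto simp: flat_signal_def)
  also have "\<dots> = (\<Sum>e\<in>C. a * y e - a\<^sup>2 / 2)"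
    using C by (simp add: sum.If_cases Int_absorb1)
  also have "\<dots> = a * (\<Sum>e\<in>C. y e) - a\<^sup>2 * card C / 2"
    by (simp add: sum_subtractf sum_distrib_left)
  finally show ?thesis by (simp add: likelihood_def)
qed

lemma card_submatrices:
  assumes "1 \<le> n" "1 \<le> m"
  shows "card (submatrices N M n m) = (N choose n) * (M choose m)"
proof -
  let ?As = "{A. A \<subseteq> {1..N} \<and> card A = n}" and ?Bs = "{B. B \<subseteq> {1..M} \<and> card B = m}"
  have "inj_on (\<lambda>(A, B). A \<times> B) (?As \<times> ?Bs)"
  proof (rule inj_onI, clarify)
    fix A B A' B'
    assume *: "A \<times> B = A' \<times> B'" "n = card A" "card A' = card A" "m = card B" "card B' = card B"
    then have "A \<noteq> {}" "B \<noteq> {}" using assms by auto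
    then show "A = A' \<and> B = B'" using times_eq_iff[THEN iffD1, OF *(1)] by blast
  qed
  from card_image[OF this] have "card ((\<lambda>(A, B). A \<times> B) ` (?As \<times> ?Bs)) = card ?As * card ?Bs"
    by (simp only: card_cartesian_product)
  moreover have "submatrices N M n m = (\<lambda>(A, B). A \<times> B) ` (?As \<times> ?Bs)"
    by (auto simp: submatrices_def)
  ultimately show ?thesis using n_subsets[of "{1..N}" n] n_subsets[of "{1..M}" m] by simp
qed

text \<open>All submatrices compete. The argument of \<^const>\<open>Phi\<close> is the level \<open>t\<close> for the logarithm of the
  likelihood ratio, centred and scaled by its mean and standard deviation under the true law; the
  denominator of the last term is a lower bound for the number of submatrices.\<close>

lemma minimax_error_ge_entropy:
  assumes nm: "1 \<le> n" "n \<le> N" "1 \<le> m" "m \<le> M" and a: "a > 0"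
  shows "minimax_error N M n m a \<ge> 1 -
    (1 - Phi ((t - a\<^sup>2 * (n * m) / 2) / (a * sqrt (n * m)))
      + exp t / ((real N / n) ^ n * (real M / m) ^ m))"
proof -
  let ?D = "submatrices N M n m"
  define w where "w = (t - a\<^sup>2 * (n * m) / 2) / (a * sqrt (n * m))"
  define Q where "Q = (real N / n) ^ n * (real M / m) ^ m"
  have Qpos: "Q > 0" using nm by (simp add: Q_def)
  have "Q \<le> real (N choose n) * real (M choose m)"
    unfolding Q_def using nm by (intro mult_mono binomial_ge_n_over_k_pow_k) auto
  then have cardD: "real (card ?D) \<ge> Q" using nm by (simp add: card_submatrices)
  then have ne: "?D \<noteq> {}" using Qpos by auto
  have tail: "measure (obs_law N M (flat_signal N M a C))
      {Y \<in> space (matrix_space N M). likelihood N M (flat_signal N M a C) Y > exp t} = 1 - Phi w"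
    if C: "C \<in> ?D" for C
  proof -
    interpret prob_space "noise_law N M" by (rule prob_space_noise_law)
    have Csub: "C \<subseteq> entries N M" by (rule submatrices_subset_entries[OF C])
    have cardC: "card C = n * m" using C by (auto simp: submatrices_def card_cartesian_product)
    then have Cne: "C \<noteq> {}" using nm by auto
    have "measure (obs_law N M (flat_signal N M a C))
        {Y \<in> space (matrix_space N M). likelihood N M (flat_signal N M a C) Y > exp t}
      = prob {\<xi> \<in> space (noise_law N M). \<not> 1 * (\<Sum>e\<in>C. \<xi> e) \<le> w * sqrt (card C)}"
    proof (subst measure_obs_law, measurable, intro arg_cong[where f = prob] Collect_cong conj_cong refl)
      fix \<xi> assume xi: "\<xi> \<in> space (noise_law N M)"
      have sum: "(\<Sum>e\<in>C. (\<lambda>e\<in>entries N M. flat_signal N M a C e + \<xi> e) e) = (n * m) * a + (\<Sum>e\<in>C. \<xi> e)"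
        using Csub cardC by (subst sum.cong[OF refl, of C _ "\<lambda>e. a + \<xi> e"])
          (auto simp: flat_signal_def sum.distrib)
      have sp: "(\<lambda>e\<in>entries N M. flat_signal N M a C e + \<xi> e) \<in> space (matrix_space N M)"
        by (auto simp: matrix_space_def space_PiM)
      have "t < a * ((n * m) * a + (\<Sum>e\<in>C. \<xi> e)) - a\<^sup>2 * (n * m) / 2
          \<longleftrightarrow> (t - a\<^sup>2 * (n * m) / 2) / a < (\<Sum>e\<in>C. \<xi> e)"
        using a by (simp add: divide_less_eq algebra_simps power2_eq_square)
      also have "(t - a\<^sup>2 * (n * m) / 2) / a = w * sqrt (card C)"
        using nm a by (auto simp: w_def cardC)
      finally show "((\<lambda>e\<in>entries N M. flat_signal N M a C e + \<xi> e) \<in>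
            {Y \<in> space (matrix_space N M). likelihood N M (flat_signal N M a C) Y > exp t})
          = (\<not> 1 * (\<Sum>e\<in>C. \<xi> e) \<le> w * sqrt (card C))"
        using sp sum cardC by (simp add: likelihood_flat_signal[OF Csub] not_le del: restrict_apply)
    qed
    also have "\<dots> = 1 - prob {\<xi> \<in> space (noise_law N M). 1 * (\<Sum>e\<in>C. \<xi> e) \<le> w * sqrt (card C)}"
    proof (rule prob_neg)
      have [measurable]: "(\<lambda>\<xi>. \<Sum>e\<in>C. \<xi> e) \<in> borel_measurable (noise_law N M)"
        using Csub by (intro borel_measurable_sum) auto
      show "{\<xi> \<in> space (noise_law N M). 1 * (\<Sum>e\<in>C. \<xi> e) \<le> w * sqrt (card C)} \<in> events" by measurable
    qed
    also have "\<dots> = 1 - Phi w" by (simp only: prob_noise_block_sum_le[OF Csub Cne abs_one])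
    finally show ?thesis .
  qed
  have "minimax_error N M n m a \<ge> 1 - (1 - Phi w + exp t / Q)"
  proof (rule minimax_error_ge_bayes[OF order_refl ne a])
    fix Chat assume Chat: "Chat \<in> selectors N M n m"
    have "(\<Sum>C\<in>?D. measure (obs_law N M (flat_signal N M a C)) {Y \<in> space (matrix_space N M). Chat Y = C})
        \<le> card ?D * (1 - Phi w) + exp t"
      using bayes_success_le_likelihood_tail[OF order_refl Chat, of "flat_signal N M a" t] by (simp add: tail)
    also have "exp t \<le> card ?D * (exp t / Q)"
      using cardD Qpos by (simp add: field_simps)
    finally show "(\<Sum>C\<in>?D. measure (obs_law N M (flat_signal N M a C)) {Y \<in> space (matrix_space N M). Chat Y = C})
        \<le> (1 - Phi w + exp t / Q) * card ?D" by (simp add: algebra_simps)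
  qed
  then show ?thesis by (simp add: w_def Q_def)
qed

text \<open>The supports that compete are the unions of \<open>k\<close> blocks; \<open>B\<close> enumerates rows restricted to a
  fixed column set, or columns restricted to a fixed row set. All these supports have the same size, so
  comparing likelihoods means comparing sums of the observation. Exchanging one block of the true
  support for one outside shows that a maximiser has no block sum below a block sum outside it. Hence
  either all block sums outside are at most \<open>t sqrt l\<close>, or all those inside are at least that; the
  two terms are the probabilities of these events.\<close>

lemma minimax_error_ge_blocks:
  fixes B :: "'i \<Rightarrow> (nat \<times> nat) set"
  assumes R: "finite R" "1 \<le> k" "k \<le> card R"
    and B: "\<And>i. i \<in> R \<Longrightarrow> B i \<subseteq> entries N M" "\<And>i. i \<in> R \<Longrightarrow> card (B i) = l" "1 \<le> l"
    and disj: "disjoint_family_on B R"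
    and subm: "\<And>A. A \<subseteq> R \<Longrightarrow> card A = k \<Longrightarrow> (\<Union>i\<in>A. B i) \<in> submatrices N M n m"
    and a: "a > 0"
  shows "minimax_error N M n m a \<ge> 1 - (Phi t ^ (card R - k) + Phi (a * sqrt l - t) ^ k)"
proof -
  define U where "U A = (\<Union>i\<in>A. B i)" for A
  define D where "D = U ` {A. A \<subseteq> R \<and> card A = k}"
  have D: "D \<subseteq> submatrices N M n m" using subm by (auto simp: D_def U_def)
  obtain A0 where "A0 \<subseteq> R" "card A0 = k" using obtain_subset_with_card_n[OF R(3)] by metis
  then have ne: "D \<noteq> {}" by (auto simp: D_def)
  have finB: "finite (B i)" if "i \<in> R" for i using B(1)[OF that] finite_entries finite_subset by blast
  have sumU: "(\<Sum>e\<in>U A. y e) = (\<Sum>i\<in>A. \<Sum>e\<in>B i. y e)" if "A \<subseteq> R" for A and y :: "nat \<times> nat \<Rightarrow> real"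
    unfolding U_def using that R(1) disj finB
    by (intro sum.UNION_disjoint) (auto simp: disjoint_family_on_def dest: finite_subset)
  have cardU: "card (U A) = k * l" if "A \<subseteq> R" "card A = k" for A
    unfolding U_def using that R(1) disj finB B(2)
    by (subst card_UN_disjoint) (auto simp: disjoint_family_on_def subset_iff rev_finite_subset)
  have main: "measure (obs_law N M (flat_signal N M a C))
      {Y \<in> space (matrix_space N M).
        \<forall>C'\<in>D. likelihood N M (flat_signal N M a C') Y \<le> likelihood N M (flat_signal N M a C) Y}
      \<le> Phi t ^ (card R - k) + Phi (a * sqrt l - t) ^ k" if "C \<in> D" for C
  proof -
    obtain A where A: "A \<subseteq> R" "card A = k" and C: "C = U A" using \<open>C \<in> D\<close> by (auto simp: D_def)
    have finA: "finite A" using A R finite_subset by blast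
    let ?s = "flat_signal N M a C"
    let ?X = "\<lambda>i (y :: nat \<times> nat \<Rightarrow> real). \<Sum>e\<in>B i. y e"
    have meas_X [measurable]: "?X i \<in> borel_measurable (matrix_space N M)" if "i \<in> R" for i
      using B(1)[OF that] by (intro borel_measurable_sum) auto
    let ?low = "{Y \<in> space (matrix_space N M). \<forall>j\<in>R - A. ?X j Y \<le> t * sqrt l}"
    let ?high = "{Y \<in> space (matrix_space N M). \<forall>i\<in>A. ?X i Y \<ge> t * sqrt l}"
    interpret P: prob_space "obs_law N M ?s" by (rule prob_space_obs_law)
    have low_sets: "?low \<in> sets (matrix_space N M)"
      using R(1) by (intro sets.sets_Collect_finite_All) auto
    have high_sets: "?high \<in> sets (matrix_space N M)"
      using finA A by (intro sets.sets_Collect_finite_All) auto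
    have swap: "?X j Y \<le> ?X i Y"
      if opt: "\<forall>C'\<in>D. likelihood N M (flat_signal N M a C') Y \<le> likelihood N M ?s Y"
        and i: "i \<in> A" and j: "j \<in> R - A" for i j Y
    proof -
      (* The only competitor that matters: exchange the blocks i and j. *)
      let ?A' = "insert j (A - {i})"
      have A': "?A' \<subseteq> R" "card ?A' = k"
        using A i j finA R(2) by (auto simp: card_insert_if)
      then have "U ?A' \<in> D" by (auto simp: D_def)
      with opt have le: "likelihood N M (flat_signal N M a (U ?A')) Y \<le> likelihood N M ?s Y" by blast
      have "U ?A' \<subseteq> entries N M" "C \<subseteq> entries N M"
        using A A' B(1) by (auto simp: U_def C dest!: subsetD)
      then have "(\<Sum>i\<in>?A'. ?X i Y) \<le> (\<Sum>i\<in>A. ?X i Y)"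
        using le a cardU[OF A'] cardU[OF A]
        by (simp add: likelihood_flat_signal C flip: sumU[OF A'(1)] sumU[OF A(1)])
      moreover have "(\<Sum>i\<in>?A'. ?X i Y) = ?X j Y + (\<Sum>i\<in>A - {i}. ?X i Y)"
        using finA j by (intro sum.insert) auto
      moreover have "(\<Sum>i\<in>A. ?X i Y) = ?X i Y + (\<Sum>i\<in>A - {i}. ?X i Y)"
        using finA i by (rule sum.remove)
      ultimately show ?thesis by linarith
    qed
    have "P.prob {Y \<in> space (matrix_space N M).
        \<forall>C'\<in>D. likelihood N M (flat_signal N M a C') Y \<le> likelihood N M ?s Y} \<le> P.prob (?low \<union> ?high)"
    proof (rule P.finite_measure_mono)
      show "{Y \<in> space (matrix_space N M).
        \<forall>C'\<in>D. likelihood N M (flat_signal N M a C') Y \<le> likelihood N M ?s Y} \<subseteq> ?low \<union> ?high"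
      proof (clarsimp)
        fix Y i j
        assume opt: "\<forall>C'\<in>D. likelihood N M (flat_signal N M a C') Y \<le> likelihood N M ?s Y"
          and i: "i \<in> A" "\<not> t * sqrt l \<le> ?X i Y" and j: "j \<in> R" "j \<notin> A"
        show "?X j Y \<le> t * sqrt l" using swap[OF opt i(1), of j] i(2) j by auto
      qed
      show "?low \<union> ?high \<in> P.events" using low_sets high_sets by auto
    qed
    also have "\<dots> \<le> P.prob ?low + P.prob ?high"
      using low_sets high_sets by (intro measure_Un_le) auto
    also have "P.prob ?low = Phi t ^ (card R - k)"
    proof -
      have "?X j (\<lambda>e\<in>entries N M. ?s e + \<xi> e) = ?X j \<xi>" if "j \<in> R - A" for j \<xi>
      proof (rule sum.cong)
        fix e assume e: "e \<in> B j"
        have "B j \<inter> B i = {}" if "i \<in> A" for i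
          using that \<open>j \<in> R - A\<close> disj A(1) by (intro disjoint_family_onD[OF disj]) auto
        with e have "e \<notin> C" by (auto simp: C U_def)
        then show "(\<lambda>e\<in>entries N M. ?s e + \<xi> e) e = \<xi> e"
          using e B(1) that by (auto simp: flat_signal_def)
      qed simp
      then have "P.prob ?low = measure (noise_law N M)
          {\<xi> \<in> space (noise_law N M). \<forall>j\<in>R - A. 1 * ?X j \<xi> \<le> t * sqrt l}"
        by (subst measure_obs_law[OF low_sets], intro arg_cong[where f = "measure _"])
          (auto simp: matrix_space_def space_PiM)
      also have "\<dots> = Phi t ^ card (R - A)"
        using R B disjoint_family_on_mono[OF Diff_subset disj]
        by (intro prob_all_noise_block_sums_le) auto
      finally show ?thesis using A R finA by (simp add: card_Diff_subset)
    qed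
    also have "P.prob ?high = Phi (a * sqrt l - t) ^ k"
    proof -
      have X: "?X i (\<lambda>e\<in>entries N M. ?s e + \<xi> e) = a * l + ?X i \<xi>" if "i \<in> A" for i \<xi>
      proof -
        have "?X i (\<lambda>e\<in>entries N M. ?s e + \<xi> e) = (\<Sum>e\<in>B i. a + \<xi> e)"
          using that A B(1) by (intro sum.cong) (auto simp: flat_signal_def C U_def)
        then show ?thesis using B(2) that A by (auto simp: sum.distrib)
      qed
      have ll: "sqrt l * sqrt l = l" by simp
      have "t * sqrt l \<le> a * l + x \<longleftrightarrow> - 1 * x \<le> (a * sqrt l - t) * sqrt l" for x
        using ll by (simp add: algebra_simps)
      with X have "P.prob ?high = measure (noise_law N M)
          {\<xi> \<in> space (noise_law N M). \<forall>i\<in>A. - 1 * ?X i \<xi> \<le> (a * sqrt l - t) * sqrt l}"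
        by (subst measure_obs_law[OF high_sets], intro arg_cong[where f = "measure _"])
          (auto simp: matrix_space_def space_PiM)
      also have "\<dots> = Phi (a * sqrt l - t) ^ card A"
        using A finA B disjoint_family_on_mono[OF A(1) disj]
        by (intro prob_all_noise_block_sums_le) auto
      finally show ?thesis using A by simp
    qed
    finally show ?thesis .
  qed
  show ?thesis
  proof (rule minimax_error_ge_bayes[OF D ne a])
    fix Chat assume Chat: "Chat \<in> selectors N M n m"
    have "(\<Sum>C\<in>D. measure (obs_law N M (flat_signal N M a C)) {Y \<in> space (matrix_space N M). Chat Y = C})
        \<le> (\<Sum>C\<in>D. Phi t ^ (card R - k) + Phi (a * sqrt l - t) ^ k)"
      by (rule order_trans[OF bayes_success_le_maximum_likelihood[OF D Chat] sum_mono[OF main]])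
    then show "(\<Sum>C\<in>D. measure (obs_law N M (flat_signal N M a C)) {Y \<in> space (matrix_space N M). Chat Y = C})
        \<le> (Phi t ^ (card R - k) + Phi (a * sqrt l - t) ^ k) * card D"
      by (simp add: mult.commute)
  qed
qed

section \<open>Rates\<close>

text \<open>The density is decreasing on the positive axis, so on the unit interval to the right of \<open>x\<close> it
  is at least its value at \<open>x + 1\<close>. The shift by 1 is harmless on the exponential scale on which the bound is
  applied.\<close>

lemma Phi_tail_ge:
  assumes "0 \<le> x"
  shows "exp (- (x + 1)\<^sup>2 / 2) / sqrt (2 * pi) \<le> 1 - Phi x"
proof -
  interpret prob_space std_normal_distribution by (rule prob_space_std_normal)
  let ?q = "exp (- (x + 1)\<^sup>2 / 2) / sqrt (2 * pi)"
  have "ennreal ?q = (\<integral>\<^sup>+z. ennreal ?q * indicator {x<..x + 1} z \<partial>lborel)"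
    by (simp add: nn_integral_cmult_indicator)
  also have "\<dots> \<le> (\<integral>\<^sup>+z. ennreal (std_normal_density z) * indicator {x<..x + 1} z \<partial>lborel)"
    using assms
    by (intro nn_integral_mono)
      (auto simp: indicator_def std_normal_density_def divide_simps intro!: ennreal_leI power_mono)
  also have "\<dots> = ennreal (prob {x<..x + 1})"
    by (subst emeasure_density[symmetric]) (auto simp: emeasure_eq_measure)
  finally have "?q \<le> prob {x<..x + 1}" by simp
  also have "\<dots> \<le> prob (space std_normal_distribution - {..x})"
    by (intro finite_measure_mono) auto
  also have "\<dots> = 1 - Phi x"
    by (subst prob_compl) (auto simp: Phi_def cdf_def)
  finally show ?thesis .
qed

text \<open>The first rate is the probability that \<open>k\<close> independent standard Gaussian variables all stay
  below \<open>c sqrt (2 ln k)\<close>, the second is the success bound of the entropy argument at the level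
  \<open>t = c H\<close>.\<close>

definition block_rate :: "real \<Rightarrow> nat \<Rightarrow> real" where
  "block_rate c k = Phi (c * sqrt (2 * ln k)) ^ k"

definition entropy_rate :: "real \<Rightarrow> real \<Rightarrow> real" where
  "entropy_rate c H = (1 - Phi ((1 - c) * sqrt (H / 2))) + exp (- (1 - c) * H)"

lemma block_rate_nonneg: "0 \<le> block_rate c k"
  by (simp add: block_rate_def Phi_nonneg)

lemma entropy_rate_nonneg: "0 \<le> entropy_rate c H"
  using Phi_le_1 by (simp add: entropy_rate_def)

text \<open>The maximum of \<open>k\<close> standard Gaussian variables is of order \<open>sqrt (2 ln k)\<close>: each
  exceeds a fraction \<open>c\<close> of this level with probability \<open>k\<close> to the power \<open>- c\<^sup>2 + o(1)\<close>, which is far larger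
  than \<open>1/k\<close>.\<close>

lemma block_rate_tendsto_0:
  assumes c: "0 < c" "c < 1"
  shows "block_rate c \<longlonglongrightarrow> 0"
proof (rule tendsto_sandwich[OF _ _ tendsto_const])
  let ?q = "\<lambda>k. exp (- (c * sqrt (2 * ln k) + 1)\<^sup>2 / 2) / sqrt (2 * pi)"
  show "\<forall>\<^sub>F k in sequentially. 0 \<le> block_rate c k" by (simp add: block_rate_nonneg)
  show "\<forall>\<^sub>F k in sequentially. block_rate c k \<le> exp (- (real k * ?q (real k)))"
    using eventually_ge_at_top[of 1]
  proof eventually_elim
    case (elim k)
    then have "?q k \<le> 1 - Phi (c * sqrt (2 * ln k))" using c by (intro Phi_tail_ge) auto
    moreover have "1 - ?q k \<le> exp (- ?q k)" using exp_ge_add_one_self[of "- ?q k"] by simp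
    ultimately have "Phi (c * sqrt (2 * ln k)) \<le> exp (- ?q k)" by linarith
    then have "block_rate c k \<le> exp (- ?q k) ^ k"
      unfolding block_rate_def by (intro power_mono Phi_nonneg)
    then show ?case by (simp flip: exp_of_nat_mult)
  qed
  have q: "filterlim (\<lambda>x::real. x * ?q x) at_top at_top"
  proof -
    (* With x = exp (y^2 / 2) the exponent becomes a difference of squares, which factorises. *)
    let ?y = "\<lambda>x::real. sqrt (2 * ln x)"
    have "filterlim (\<lambda>x. (1 - c) * ?y x - 1) at_top at_top" using c by real_asymp
    moreover have "filterlim (\<lambda>x. (1 + c) * ?y x + 1) at_top at_top" using c by real_asymp
    ultimately have "filterlim (\<lambda>x. ((1 - c) * ?y x - 1) * ((1 + c) * ?y x + 1)) at_top at_top"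
      by (rule filterlim_at_top_mult_at_top)
    moreover have "filterlim (\<lambda>z::real. exp (z / 2) / sqrt (2 * pi)) at_top at_top" by real_asymp
    ultimately have lim: "filterlim (\<lambda>x. exp (((1 - c) * ?y x - 1) * ((1 + c) * ?y x + 1) / 2)
        / sqrt (2 * pi)) at_top at_top"
      by (rule filterlim_compose[rotated])
    show ?thesis
    proof (rule filterlim_at_top_mono[OF lim], use eventually_ge_at_top[of 1] in eventually_elim)
      case (elim x)
      then have "x = exp ((?y x)\<^sup>2 / 2)" by simp
      then have "x * exp (- (c * ?y x + 1)\<^sup>2 / 2) = exp ((?y x)\<^sup>2 / 2) * exp (- (c * ?y x + 1)\<^sup>2 / 2)"
        by simp
      also have "\<dots> = exp (((1 - c) * ?y x - 1) * ((1 + c) * ?y x + 1) / 2)"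
        by (simp add: algebra_simps power2_eq_square add_divide_distrib diff_divide_distrib
            flip: exp_add)
      finally show ?case by simp
    qed
  qed
  show "(\<lambda>k. exp (- (real k * ?q (real k)))) \<longlonglongrightarrow> 0"
    by (intro filterlim_compose[OF exp_at_bot] filterlim_compose[OF filterlim_uminus_at_bot_at_top]
        filterlim_compose[OF q filterlim_real_sequentially])
qed

lemma entropy_rate_tendsto_0:
  assumes c: "c < 1"
  shows "(entropy_rate c \<longlongrightarrow> 0) at_top"
proof -
  have "filterlim (\<lambda>H::real. (1 - c) * sqrt (H / 2)) at_top at_top" using c by real_asymp
  from filterlim_compose[OF Phi_at_top this]
  have "((\<lambda>H. 1 - Phi ((1 - c) * sqrt (H / 2))) \<longlongrightarrow> 1 - 1) at_top"
    by (intro tendsto_diff tendsto_const)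
  moreover have "((\<lambda>H::real. exp (- (1 - c) * H)) \<longlongrightarrow> 0) at_top" using c by real_asymp
  ultimately have "((\<lambda>H. (1 - Phi ((1 - c) * sqrt (H / 2))) + exp (- (1 - c) * H)) \<longlongrightarrow> (1 - 1) + 0) at_top"
    by (rule tendsto_add)
  then show ?thesis by (simp add: entropy_rate_def[abs_def])
qed

text \<open>The hypothesis says that the shift \<open>x\<close> of the inside block sums is at most \<open>c sqrt (2 ln k)\<close>
  above the threshold \<open>c sqrt (2 ln (K - k))\<close>; this is how the sum of two square roots in the
  bounds for rows and columns arises.\<close>

lemma block_error_le_rates:
  assumes k: "2 \<le> k" "k + 2 \<le> K"
    and le: "x / (sqrt 2 * (sqrt (ln (real k)) + sqrt (ln (real K - real k)))) < c"
  shows "Phi (c * sqrt (2 * ln (real (K - k)))) ^ (K - k)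
      + Phi (x - c * sqrt (2 * ln (real (K - k)))) ^ k \<le> block_rate c k + block_rate c (K - k)"
proof -
  have eq: "real K - real k = real (K - k)" using k by simp
  have "0 < sqrt 2 * (sqrt (ln (real k)) + sqrt (ln (real (K - k))))"
    using k by (intro mult_pos_pos add_pos_pos) auto
  then have "x \<le> c * (sqrt 2 * (sqrt (ln (real k)) + sqrt (ln (real (K - k)))))"
    using le by (simp add: eq divide_less_eq)
  then have "x - c * sqrt (2 * ln (real (K - k))) \<le> c * sqrt (2 * ln (real k))"
    by (simp add: real_sqrt_mult algebra_simps)
  then show ?thesis
    unfolding block_rate_def by (auto intro!: power_mono Phi_mono Phi_nonneg)
qed

text \<open>The blocks are the rows restricted to the first \<open>m\<close> columns.\<close>

lemma minimax_error_ge_if_bound_A1: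
  assumes nm: "2 \<le> n" "n + 2 \<le> N" "1 \<le> m" "m \<le> M" and a: "a > 0"
    and A1: "bound_A1 N M n m a < c"
  shows "minimax_error N M n m a \<ge> 1 - (block_rate c n + block_rate c (N - n))"
proof -
  have "1 - (Phi (c * sqrt (2 * ln (real (N - n)))) ^ (card {1..N} - n)
      + Phi (a * sqrt m - c * sqrt (2 * ln (real (N - n)))) ^ n) \<le> minimax_error N M n m a"
  proof (rule minimax_error_ge_blocks[where B = "\<lambda>i. {i} \<times> {1..m}"])
    fix A assume "A \<subseteq> {1..N}" "card A = n"
    then have "A \<times> {1..m} \<in> submatrices N M n m"
      using nm by (intro times_in_submatrices) auto
    also have "A \<times> {1..m} = (\<Union>i\<in>A. {i} \<times> {1..m})" by auto
    finally show "(\<Union>i\<in>A. {i} \<times> {1..m}) \<in> submatrices N M n m" .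
  qed (use nm a in \<open>auto simp: entries_def disjoint_family_on_def\<close>)
  with block_error_le_rates[OF nm(1,2) A1[unfolded bound_A1_def]] show ?thesis by simp
qed

lemma minimax_error_ge_if_bound_A2:
  assumes nm: "1 \<le> n" "n \<le> N" "2 \<le> m" "m + 2 \<le> M" and a: "a > 0"
    and A2: "bound_A2 N M n m a < c"
  shows "minimax_error N M n m a \<ge> 1 - (block_rate c m + block_rate c (M - m))"
proof -
  have "1 - (Phi (c * sqrt (2 * ln (real (M - m)))) ^ (card {1..M} - m)
      + Phi (a * sqrt n - c * sqrt (2 * ln (real (M - m)))) ^ m) \<le> minimax_error N M n m a"
  proof (rule minimax_error_ge_blocks[where B = "\<lambda>j. {1..n} \<times> {j}"])
    fix B assume "B \<subseteq> {1..M}" "card B = m"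
    then have "{1..n} \<times> B \<in> submatrices N M n m"
      using nm by (intro times_in_submatrices) auto
    also have "{1..n} \<times> B = (\<Union>j\<in>B. {1..n} \<times> {j})" by auto
    finally show "(\<Union>j\<in>B. {1..n} \<times> {j}) \<in> submatrices N M n m" .
  qed (use nm a in \<open>auto simp: entries_def disjoint_family_on_def card_cartesian_product\<close>)
  with block_error_le_rates[OF nm(3,4) A2[unfolded bound_A2_def]] show ?thesis by simp
qed

text \<open>For \<open>c < 1\<close> the level \<open>t = c H\<close> lies strictly between the mean of the log-likelihood ratio, at most
  \<open>c\<^sup>2 H\<close>, and the logarithm of the number of submatrices, at least \<open>H\<close>.\<close>

lemma minimax_error_ge_if_bound_A:
  assumes nm: "1 \<le> n" "n < N" "1 \<le> m" "m < M" and a: "a > 0" and c: "0 < c"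
    and A: "bound_A N M n m a < c"
  shows "minimax_error N M n m a
    \<ge> 1 - entropy_rate c (real n * ln (real N / real n) + real m * ln (real M / real m))"
proof -
  define H where "H = real n * ln (real N / real n) + real m * ln (real M / real m)"
  define b where "b = a * sqrt (real (n * m))"
  have "0 < real n * ln (real N / real n)" "0 < real m * ln (real M / real m)"
    using nm by (auto intro!: mult_pos_pos simp: less_divide_eq)
  then have H: "H > 0" by (simp add: H_def)
  have b: "b > 0" using a nm by (simp add: b_def)
  have "bound_A N M n m a = b / sqrt (2 * H)"
    by (simp add: bound_A_def Let_def b_def H_def)
  then have b_le: "b < c * sqrt (2 * H)" using A H by (simp add: divide_less_eq)
  have "exp H = (real N / n) ^ n * (real M / m) ^ m"
    using nm by (simp add: H_def exp_add exp_of_nat_mult)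
  then have exps: "exp (c * H) / ((real N / n) ^ n * (real M / m) ^ m) = exp (- (1 - c) * H)"
    unfolding \<open>exp H = _\<close>[symmetric] by (simp add: algebra_simps flip: exp_diff)
  have bsq: "a\<^sup>2 * (n * m) = b\<^sup>2" by (simp add: b_def power_mult_distrib)
  have "(1 - c) * sqrt (H / 2) \<le> (c * H - b\<^sup>2 / 2) / b"
  proof -
    (* The right-hand side decreases in b and equals the left-hand side at b = 2 c h. *)
    define h where "h = sqrt (H / 2)"
    have h: "h > 0" "H = 2 * h\<^sup>2" "sqrt (2 * H) = 2 * h"
      using H by (auto simp: h_def real_sqrt_divide real_sqrt_mult field_simps)
    have "0 \<le> (2 * c * h - b) * (h + b / 2)"
      using b_le b h by (intro mult_nonneg_nonneg) auto
    then have "(1 - c) * h * b \<le> c * H - b\<^sup>2 / 2"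
      by (simp add: h(2) algebra_simps power2_eq_square)
    then show ?thesis using b by (simp add: h_def[symmetric] le_divide_eq)
  qed
  from Phi_mono[OF this]
  have "1 - Phi ((c * H - a\<^sup>2 * (n * m) / 2) / (a * sqrt (n * m))) \<le> 1 - Phi ((1 - c) * sqrt (H / 2))"
    by (simp only: bsq b_def)
  with minimax_error_ge_entropy[of n N m M a "c * H"] nm a show ?thesis
    unfolding exps entropy_rate_def H_def[symmetric] by simp
qed

section \<open>The impossibility theorem\<close>

lemma filterlim_diff_of_ratio_tendsto_0:
  fixes k K :: "'a \<Rightarrow> nat"
  assumes k: "filterlim k at_top F" and ratio: "((\<lambda>x. real (k x) / real (K x)) \<longlongrightarrow> 0) F"
    and K: "eventually (\<lambda>x. K x > 0) F"
  shows "filterlim (\<lambda>x. K x - k x) at_top F"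
proof (rule filterlim_at_top_mono[OF k])
  show "\<forall>\<^sub>F x in F. k x \<le> K x - k x"
    using order_tendstoD(2)[OF ratio half_gt_zero[OF zero_less_one]] K
    by eventually_elim (auto simp: divide_less_eq)
qed

lemma ln_inverse_ratio_ge_1:
  fixes k K :: "'a \<Rightarrow> nat"
  assumes k: "filterlim k at_top F" and ratio: "((\<lambda>x. real (k x) / real (K x)) \<longlongrightarrow> 0) F"
    and K: "eventually (\<lambda>x. K x > 0) F"
  shows "\<forall>\<^sub>F x in F. 1 \<le> ln (real (K x) / real (k x))"
  using order_tendstoD(2)[OF ratio exp_gt_zero[of "-1"]] K
    filterlim_at_top[THEN iffD1, OF k, rule_format, of 1]
proof eventually_elim
  case (elim x)
  then have "exp 1 \<le> real (K x) / real (k x)"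
    by (simp add: exp_minus field_simps)
  then show ?case using elim by (subst ln_ge_iff) auto
qed

theorem theorem2p2:
  fixes n m :: "nat \<Rightarrow> nat \<Rightarrow> nat" and a :: "nat \<Rightarrow> nat \<Rightarrow> real"
  assumes "filterlim (\<lambda>(N, M). n N M) at_top NM_at_top"
    and "((\<lambda>(N, M). real (n N M) / real N) \<longlongrightarrow> 0) NM_at_top"
    and "filterlim (\<lambda>(N, M). m N M) at_top NM_at_top"
    and "((\<lambda>(N, M). real (m N M) / real M) \<longlongrightarrow> 0) NM_at_top"
    and "\<And>N M. a N M > 0"
    and "Limsup NM_at_top (\<lambda>(N, M). ereal (bound_B N M (n N M) (m N M) (a N M))) < 1"
  shows "((\<lambda>(N, M). minimax_error N M (n N M) (m N M) (a N M)) \<longlongrightarrow> 1) NM_at_top"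
proof -
  let ?F = NM_at_top
  let ?n = "\<lambda>x. n (fst x) (snd x)" and ?m = "\<lambda>x. m (fst x) (snd x)"
  have n: "filterlim ?n at_top ?F" and m: "filterlim ?m at_top ?F"
    and p: "((\<lambda>x. real (?n x) / real (fst x)) \<longlongrightarrow> 0) ?F"
    and q: "((\<lambda>x. real (?m x) / real (snd x)) \<longlongrightarrow> 0) ?F"
    using assms(1-4) by (simp_all add: case_prod_beta')
  have N: "\<forall>\<^sub>F x in ?F. 0 < fst x" and M: "\<forall>\<^sub>F x in ?F. 0 < snd x"
    by (rule eventually_compose_filterlim[OF eventually_gt_at_top filterlim_fst]
        eventually_compose_filterlim[OF eventually_gt_at_top filterlim_snd])+
  have Nn: "filterlim (\<lambda>x. fst x - ?n x) at_top ?F" and Mm: "filterlim (\<lambda>x. snd x - ?m x) at_top ?F"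
    using filterlim_diff_of_ratio_tendsto_0[OF n p N] filterlim_diff_of_ratio_tendsto_0[OF m q M] .
  obtain c :: real where c: "0 < c" "c < 1"
    and B: "\<forall>\<^sub>F x in ?F. bound_B (fst x) (snd x) (?n x) (?m x) (a (fst x) (snd x)) < c"
  proof -
    obtain d where d: "Limsup ?F (\<lambda>(N, M). ereal (bound_B N M (n N M) (m N M) (a N M))) < ereal d"
      "ereal d < 1"
      using ereal_dense2[OF assms(6)] by auto
    have "\<forall>\<^sub>F x in ?F. bound_B (fst x) (snd x) (?n x) (?m x) (a (fst x) (snd x)) < max d (1/2)"
      using Limsup_lessD[OF d(1)] by eventually_elim (auto simp: case_prod_beta')
    (* The maximum with 1/2 makes the constant positive. *)
    then show ?thesis using d(2) by (intro that[of "max d (1/2)"]) (auto simp: one_ereal_def)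
  qed
  define H where "H x = real (?n x) * ln (real (fst x) / real (?n x))
      + real (?m x) * ln (real (snd x) / real (?m x))" for x
  have H: "filterlim H at_top ?F"
  proof (rule filterlim_at_top_mono)
    show "filterlim (\<lambda>x. real (?n x)) at_top ?F"
      by (rule filterlim_compose[OF filterlim_real_sequentially n])
    show "\<forall>\<^sub>F x in ?F. real (?n x) \<le> H x"
      using ln_inverse_ratio_ge_1[OF n p N] ln_inverse_ratio_ge_1[OF m q M]
    proof eventually_elim
      case (elim x)
      then have "real (?n x) * 1 \<le> real (?n x) * ln (real (fst x) / real (?n x))"
        by (intro mult_left_mono) auto
      moreover have "0 \<le> real (?m x) * ln (real (snd x) / real (?m x))"
        using elim by (intro mult_nonneg_nonneg) auto
      ultimately show ?case by (simp add: H_def)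
    qed
  qed
  (* Which of the three bounds is small may vary with (N, M), so all rates are added up. *)
  define rate where "rate x = block_rate c (?n x) + block_rate c (fst x - ?n x)
      + block_rate c (?m x) + block_rate c (snd x - ?m x) + entropy_rate c (H x)" for x
  have "(rate \<longlongrightarrow> 0 + 0 + 0 + 0 + 0) ?F"
    unfolding rate_def[abs_def]
    by (intro tendsto_add filterlim_compose[OF block_rate_tendsto_0[OF c]]
        filterlim_compose[OF entropy_rate_tendsto_0[OF c(2)]] n m Nn Mm H)
  then have "((\<lambda>x. 1 - rate x) \<longlongrightarrow> 1 - 0) ?F" by (intro tendsto_diff tendsto_const) simp
  then have rate: "((\<lambda>x. 1 - rate x) \<longlongrightarrow> 1) ?F" by simp
  have sizes: "\<forall>\<^sub>F x in ?F. 2 \<le> ?n x \<and> ?n x + 2 \<le> fst x \<and> 2 \<le> ?m x \<and> ?m x + 2 \<le> snd x"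
  proof -
    note ge2 = filterlim_at_top[THEN iffD1, rule_format, of _ _ 2]
    show ?thesis using ge2[OF n] ge2[OF m] ge2[OF Nn] ge2[OF Mm] by eventually_elim auto
  qed
  have "((\<lambda>x. minimax_error (fst x) (snd x) (?n x) (?m x) (a (fst x) (snd x))) \<longlongrightarrow> 1) ?F"
  proof (rule tendsto_sandwich[OF _ _ rate tendsto_const])
    show "\<forall>\<^sub>F x in ?F. minimax_error (fst x) (snd x) (?n x) (?m x) (a (fst x) (snd x)) \<le> 1"
      using sizes
    proof eventually_elim
      case (elim x)
      then have "{1..?n x} \<times> {1..?m x} \<in> submatrices (fst x) (snd x) (?n x) (?m x)"
        by (intro times_in_submatrices) auto
      then show ?case by (intro minimax_error_le_1) auto
    qed
    show "\<forall>\<^sub>F x in ?F. 1 - rate x \<le> minimax_error (fst x) (snd x) (?n x) (?m x) (a (fst x) (snd x))"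
      using sizes B
    proof eventually_elim
      case (elim x)
      obtain N M where x: "x = (N, M)" by (cases x)
      note nonneg = block_rate_nonneg[of c "n N M"] block_rate_nonneg[of c "N - n N M"]
        block_rate_nonneg[of c "m N M"] block_rate_nonneg[of c "M - m N M"]
        entropy_rate_nonneg[of c "H (N, M)"]
      consider "bound_A1 N M (n N M) (m N M) (a N M) < c" | "bound_A2 N M (n N M) (m N M) (a N M) < c"
        | "bound_A N M (n N M) (m N M) (a N M) < c"
        using elim(2) by (auto simp: x bound_B_def min_less_iff_disj)
      then show ?case
      proof cases
        case 1
        with minimax_error_ge_if_bound_A1[of "n N M" N "m N M" M "a N M" c] elim(1) assms(5) nonneg
        show ?thesis by (simp add: x rate_def)
      next
        case 2
        with minimax_error_ge_if_bound_A2[of "n N M" N "m N M" M "a N M" c] elim(1) assms(5) nonneg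
        show ?thesis by (simp add: x rate_def)
      next
        case 3
        with minimax_error_ge_if_bound_A[of "n N M" N "m N M" M "a N M" c] elim(1) assms(5) c nonneg
        show ?thesis by (simp add: x rate_def H_def)
      qed
    qed
  qed
  then show ?thesis by (simp add: case_prod_beta')
qed

end
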